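(* Let $P\in\mathbb{C}[x]$ be a polynomial with $x\nmid P(x)$, let $n=\deg P$, so that $C(P)=n+1$, and let $\widetilde{P}$ be its Reversing. Let $Q\in\mathbb{C}[x]$ be another polynomial with $x\nmid Q(x)$. Then: 1. $\widetilde{P}(x)=x^{n}P(1/x)$. 2. For every nonzero $\alpha\in\mathbb{C}$: $\widetilde{P}(1/\alpha)=0$ if and only if $P(\alpha)=0$. 3. For $\alpha_1,\dots,\alpha_n,\beta_1,\dots,\beta_n\in\mathbb{C}$: $\widetilde{P}(x)=(-1)^n(\alpha_1x-\beta_1)(\alpha_2x-\beta_2)\cdots(\alpha_nx-\beta_n)$ if and only if $P(x)=(\beta_1x-\alpha_1)\cdots(\beta_nx-\alpha_n)$. 4. $\widetilde{\widetilde{P}}=P$. 5. $C(P)=C(\widetilde{P})$. 6. If $C(P)=C(Q)$, then $\widetilde{P+Q}=\widetilde{P}+\widetilde{Q}$. 7. $\widetilde{P\cdot Q}=\widetilde{P}\cdot\widetilde{Q}$.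
   Context: Only polynomials $P$ with $x\nmid P(x)$ (nonzero constant term) are considered. Such a $P\in\mathbb{C}[x]$ of degree $n$ is written $P(x)=\sum_{k=0}^{n}a_{n-k}x^{n-k}$, and $C(P)=1+\deg P=n+1$ denotes its number of coefficients. The Reversing of $P$ is $\widetilde{P}(x)=\sum_{k=0}^{n}b_{n-k}x^{n-k}$ with $b_{n-k}=a_k$ for $k=0,1,\dots,n$. If $P$ and $Q$ both have degree $n$, with coefficients $a_j$ and $b_j$, then $P+Q$ is regarded as written $\sum_{k=0}^{n}(a_{n-k}+b_{n-k})x^{n-k}$ with the same $n$, and its Reversing is formed from this expression (reversal with respect to $n$), even if some of these coefficients vanish. *)

theory Defs
  imports Complex_Main "HOL-Computational_Algebra.Polynomial"
begin

text \<open>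
  Reversal of a polynomial regarded as written with the coefficients \<open>a\<^sub>0, \<dots>, a\<^sub>n\<close>, where
  \<open>n\<close> need not be the degree: the coefficient \<open>a\<^sub>k\<close> becomes the coefficient of \<open>x\<^sup>n\<^sup>-\<^sup>k\<close>.
  It is meaningful only if \<open>n\<close> is at least the degree (higher coefficients are dropped).
\<close>
definition reversing_wrt :: "nat \<Rightarrow> complex poly \<Rightarrow> complex poly" where
  "reversing_wrt n P = (\<Sum>k\<le>n. monom (coeff P k) (n - k))"

definition reversing :: "complex poly \<Rightarrow> complex poly" where
  "reversing P = reversing_wrt (degree P) P"

text \<open>Vanishing intermediate coefficients are counted too.\<close>
definition coeff_count :: "complex poly \<Rightarrow> nat" where
  "coeff_count P = 1 + degree P"

lemma coeff_reversing_wrt: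
  "coeff (reversing_wrt n P) i = (if i \<le> n then coeff P (n - i) else 0)"
proof -
  have "coeff (reversing_wrt n P) i = (\<Sum>k\<le>n. if n - k = i then coeff P k else 0)"
    by (simp add: reversing_wrt_def coeff_sum)
  also have "\<dots> = (\<Sum>k\<le>n. if k = n - i then (if i \<le> n then coeff P k else 0) else 0)"
    by (rule sum.cong) auto
  also have "\<dots> = (if i \<le> n then coeff P (n - i) else 0)"
    by simp
  finally show ?thesis .
qed

lemma reversing_eq_reflect_poly: "reversing P = reflect_poly P"
  by (rule poly_eqI) (simp add: reversing_def coeff_reversing_wrt coeff_reflect_poly)

end

theory Submission
  imports Defs
begin

text \<open>Everything rests on \<open>reversing P\<close> being x^n P(1/x), with n the degree of P.
  At x = 1/\<alpha> the power of x is nonzero, so roots are inverted. Since -(\<alpha> x - \<beta>)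
  = x (\<beta>/x - \<alpha>), linear factors are exchanged one by one; values at nonzero points then
  determine the polynomials (\<open>poly_eqI_nonzero\<close>). Degrees add under products, so
  reversal is multiplicative. A nonzero constant term becomes the leading coefficient, so the degree
  is kept and reversal is an involution.\<close>

lemma poly_eqI_nonzero:
  fixes p q :: "'a :: {comm_ring_1, ring_no_zero_divisors, ring_char_0} poly"
  assumes "\<And>x. x \<noteq> 0 \<Longrightarrow> poly p x = poly q x"
  shows "p = q"
proof -
  \<comment> \<open>The factor x forces agreement at 0 as well and can be cancelled
    afterwards.\<close>
  have "poly ([:0, 1:] * p) = poly ([:0, 1:] * q)"
    using assms by (intro ext) auto
  then have "[:0, 1:] * p = [:0, 1:] * q"
    by (simp only: poly_eq_poly_eq_iff)
  then show ?thesis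
    by simp
qed

text \<open>Each of the n factors contributes one sign and one power of x. Zero values of \<alpha>
  or \<beta> are harmless, as only x is inverted.\<close>

lemma poly_prod_linear_reciprocal:
  fixes \<alpha> \<beta> :: "nat \<Rightarrow> 'a :: field"
  assumes "x \<noteq> 0"
  shows "poly (smult ((-1) ^ n) (\<Prod>i=1..n. [:- \<beta> i, \<alpha> i:])) x
    = x ^ n * poly (\<Prod>i=1..n. [:- \<alpha> i, \<beta> i:]) (1 / x)"
proof -
  have "poly (smult ((-1) ^ n) (\<Prod>i=1..n. [:- \<beta> i, \<alpha> i:])) x
      = (\<Prod>i=1..n. - 1 * (x * \<alpha> i - \<beta> i))"
    by (simp only: prod.distrib) (simp add: poly_prod)
  also have "\<dots> = (\<Prod>i=1..n. x * (\<beta> i / x - \<alpha> i))"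
    using assms by (intro prod.cong) (simp_all add: field_simps)
  also have "\<dots> = x ^ n * poly (\<Prod>i=1..n. [:- \<alpha> i, \<beta> i:]) (1 / x)"
    by (simp only: prod.distrib) (simp add: poly_prod)
  finally show ?thesis .
qed

theorem proposition2p2:
  fixes P Q :: "complex poly" and n :: nat
  assumes "\<not> [:0, 1:] dvd P"
    and "\<not> [:0, 1:] dvd Q"
    and "n = degree P"
  shows "(\<forall>x. x \<noteq> 0 \<longrightarrow> poly (reversing P) x = x ^ n * poly P (1 / x))
    \<and> (\<forall>\<alpha>. \<alpha> \<noteq> 0 \<longrightarrow> (poly (reversing P) (1 / \<alpha>) = 0 \<longleftrightarrow> poly P \<alpha> = 0))
    \<and> (\<forall>\<alpha> \<beta> :: nat \<Rightarrow> complex.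
          reversing P = smult ((-1) ^ n) (\<Prod>i=1..n. [:- \<beta> i, \<alpha> i:])
            \<longleftrightarrow> P = (\<Prod>i=1..n. [:- \<alpha> i, \<beta> i:]))
    \<and> reversing (reversing P) = P
    \<and> coeff_count P = coeff_count (reversing P)
    \<and> (coeff_count P = coeff_count Q
          \<longrightarrow> reversing_wrt n (P + Q) = reversing P + reversing Q)
    \<and> reversing (P * Q) = reversing P * reversing Q"
proof -
  have P0: "coeff P 0 \<noteq> 0"
    using assms(1) by (simp add: dvd_iff_poly_eq_0[of 0, simplified] poly_0_coeff_0)
  have eval: "poly (reversing P) x = x ^ n * poly P (1 / x)" if "x \<noteq> 0" for x
    using that by (simp add: reversing_eq_reflect_poly poly_reflect_poly_nz assms(3) inverse_eq_divide)
  have roots: "poly (reversing P) (1 / \<alpha>) = 0 \<longleftrightarrow> poly P \<alpha> = 0" if "\<alpha> \<noteq> 0" for \<alpha>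
    using eval[of "1 / \<alpha>"] that by simp
  have factors: "reversing P = smult ((-1) ^ n) (\<Prod>i=1..n. [:- \<beta> i, \<alpha> i:])
      \<longleftrightarrow> P = (\<Prod>i=1..n. [:- \<alpha> i, \<beta> i:])" (is "_ = ?R \<longleftrightarrow> _ = ?L")
    for \<alpha> \<beta> :: "nat \<Rightarrow> complex"
  proof
    assume rev: "reversing P = ?R"
    show "P = ?L"
    \<comment> \<open>Both identities are taken at 1/x, and the common nonzero factor (1/x)^n
      cancels.\<close>
    proof (rule poly_eqI_nonzero)
      fix x :: complex
      assume "x \<noteq> 0"
      then show "poly P x = poly ?L x"
        using eval[of "1 / x"] poly_prod_linear_reciprocal[of "1 / x" n \<beta> \<alpha>] rev by simp
    qed
  next
    assume fac: "P = ?L"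
    show "reversing P = ?R"
    proof (rule poly_eqI_nonzero)
      fix x :: complex
      assume "x \<noteq> 0"
      then show "poly (reversing P) x = poly ?R x"
        using eval[of x] poly_prod_linear_reciprocal[of x n \<beta> \<alpha>] fac by simp
    qed
  qed
  \<comment> \<open>Equal counts give Q degree n too, so all three reversals send index i to n - i.
    Fixing n matters because leading terms of P + Q may cancel.\<close>
  have add: "reversing_wrt n (P + Q) = reversing P + reversing Q"
    if "coeff_count P = coeff_count Q"
    using that assms(3)
    by (intro poly_eqI) (simp add: reversing_def coeff_reversing_wrt coeff_count_def)
  show ?thesis
    using P0 eval roots factors add
    by (simp add: reversing_eq_reflect_poly reflect_poly_mult coeff_count_def)
qed

end
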